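(* There exist sufficiently small absolute constants $\delta_0,\epsilon_0\in(0,1)$ such that the following holds. Suppose $\delta<\delta_0$, $\epsilon<\epsilon_0$, and $n\geq\lceil 64\epsilon^{-1}\log(6/\delta)\rceil$. Let $S$ be a sketching matrix with $n$ columns such that, for inputs $x\in\mathbb{R}^n$, from $Sx$ one succeeds with probability at least $1-\delta$ in returning a set containing all the $\epsilon$-heavy hitters of $x$ and containing no item which is not an $(\epsilon/2)$-heavy hitter, where heavy hitters are with respect to the $\ell_2$ norm. Then $S$ has $\Omega(\epsilon^{-1}\log(1/\delta))$ rows.
   Context: $x_i$ is an $\epsilon$-heavy hitter in $\ell_2$ if $x_i^2 \geq \epsilon\|x\|_2^2$. *)

theory Defs
  imports "HOL-Probability.Probability"
begin

text \<open>
  Dimensions are natural numbers bound inside the theorem, so \<open>\<real>\<^sup>k\<close> and \<open>\<real>\<^sup>m\<^sup>\<times>\<^sup>n\<close> are the product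
  Borel spaces over index sets \<open>{..<k}\<close> and \<open>{..<m} \<times> {..<n}\<close>; their points are extensional functions.
\<close>

abbreviation vec_space :: "nat \<Rightarrow> (nat \<Rightarrow> real) measure" where
  "vec_space k \<equiv> PiM {..<k} (\<lambda>_. borel)"

abbreviation mat_space :: "nat \<Rightarrow> nat \<Rightarrow> (nat \<times> nat \<Rightarrow> real) measure" where
  "mat_space m n \<equiv> PiM ({..<m} \<times> {..<n}) (\<lambda>_. borel)"

definition mat_vec :: "nat \<Rightarrow> nat \<Rightarrow> (nat \<times> nat \<Rightarrow> real) \<Rightarrow> (nat \<Rightarrow> real) \<Rightarrow> (nat \<Rightarrow> real)" where
  "mat_vec m n S x = (\<lambda>i\<in>{..<m}. \<Sum>j<n. S (i, j) * x j)"

definition heavy_hitters :: "nat \<Rightarrow> real \<Rightarrow> (nat \<Rightarrow> real) \<Rightarrow> nat set" where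
  "heavy_hitters n \<epsilon> x = {i \<in> {..<n}. (x i)\<^sup>2 \<ge> \<epsilon> * (L2_set x {..<n})\<^sup>2}"

text \<open>
  A sketch is the law \<open>\<mu>\<close> of a random \<open>m \<times> n\<close> matrix. A decoder \<open>D\<close> is a Markov kernel: it sees the
  matrix \<open>S\<close> and the sketch \<open>S x\<close>, may use fresh randomness, and returns a set of coordinates.
\<close>

definition is_sketch :: "nat \<Rightarrow> nat \<Rightarrow> (nat \<times> nat \<Rightarrow> real) measure \<Rightarrow> bool" where
  "is_sketch m n \<mu> \<longleftrightarrow> \<mu> \<in> space (prob_algebra (mat_space m n))"

definition is_decoder ::
    "nat \<Rightarrow> nat \<Rightarrow> ((nat \<times> nat \<Rightarrow> real) \<times> (nat \<Rightarrow> real) \<Rightarrow> nat set measure) \<Rightarrow> bool" where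
  "is_decoder m n D \<longleftrightarrow>
     D \<in> measurable (mat_space m n \<Otimes>\<^sub>M vec_space m) (prob_algebra (count_space (Pow {..<n})))"

definition output_law ::
    "nat \<Rightarrow> nat \<Rightarrow> (nat \<times> nat \<Rightarrow> real) measure \<Rightarrow>
     ((nat \<times> nat \<Rightarrow> real) \<times> (nat \<Rightarrow> real) \<Rightarrow> nat set measure) \<Rightarrow> (nat \<Rightarrow> real) \<Rightarrow> nat set measure" where
  "output_law m n \<mu> D x = \<mu> \<bind> (\<lambda>S. D (S, mat_vec m n S x))"

definition solves_heavy_hitters ::
    "nat \<Rightarrow> nat \<Rightarrow> real \<Rightarrow> real \<Rightarrow> (nat \<times> nat \<Rightarrow> real) measure \<Rightarrow>
     ((nat \<times> nat \<Rightarrow> real) \<times> (nat \<Rightarrow> real) \<Rightarrow> nat set measure) \<Rightarrow> bool" where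
  "solves_heavy_hitters m n \<epsilon> \<delta> \<mu> D \<longleftrightarrow>
     (\<forall>x \<in> space (vec_space n).
        measure (output_law m n \<mu> D x)
          {A. heavy_hitters n \<epsilon> x \<subseteq> A \<and> A \<subseteq> heavy_hitters n (\<epsilon> / 2) x} \<ge> 1 - \<delta>)"

end

theory Submission
  imports Defs
begin

text \<open>
  Let \<open>g\<close> be a standard Gaussian vector in \<open>\<real>\<^sup>n\<close> and \<open>t\<^sup>2 = 100 \<epsilon> n / 8\<close>. Up to probability \<open>O(\<delta>)\<close>,
  coordinate \<open>i\<close> is not an \<open>\<epsilon> / 2\<close>-heavy hitter of \<open>g\<close> but is an \<open>\<epsilon>\<close>-heavy hitter of \<open>g + t e\<^sub>i\<close>, so the
  decoder tests one against the other with error \<open>O(\<delta>)\<close>. If \<open>P\<close> is the orthogonal projection onto the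
  row space of \<open>S\<close>, then \<open>S (g + t e\<^sub>i) = S (g + t P e\<^sub>i)\<close>, and the laws of \<open>g\<close> and \<open>g + t P e\<^sub>i\<close> cannot be
  tested with total error below \<open>exp (- t\<^sup>2 |P e\<^sub>i|\<^sup>2 / 4) / 2\<close>. Since the numbers \<open>|P e\<^sub>i|\<^sup>2\<close> sum to
  the rank of \<open>S\<close>, at most \<open>m\<close>, averaging over \<open>i\<close> and \<open>S\<close> gives
  \<open>exp (- t\<^sup>2 m / (4 n)) = O(\<delta>)\<close>.
\<close>

subsection \<open>Projection onto the row space\<close>

text \<open>Gram-Schmidt, one row at a time: the projection onto the span of the earlier rows gains
  a rank-one term for the part of the next row orthogonal to them. The trace stands in for the rank
  and grows by at most 1 per row.\<close>

lemma row_space_projection: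
  fixes S :: "nat \<times> nat \<Rightarrow> real"
  shows "\<exists>P :: nat \<Rightarrow> nat \<Rightarrow> real.
    (\<forall>i j. P i j = P j i) \<and>
    (\<forall>i<n. \<forall>j<n. (\<Sum>k<n. P i k * P k j) = P i j) \<and>
    (\<forall>k<m. \<forall>i<n. (\<Sum>j<n. P i j * S (k, j)) = S (k, i)) \<and>
    (\<Sum>i<n. P i i) \<le> real m"
proof (induction m)
  case 0
  show ?case by (intro exI[of _ "\<lambda>_ _. 0"]) auto
next
  case (Suc m)
  then obtain P :: "nat \<Rightarrow> nat \<Rightarrow> real" where sym: "\<And>i j. P i j = P j i"
    and idem: "\<And>i j. i < n \<Longrightarrow> j < n \<Longrightarrow> (\<Sum>k<n. P i k * P k j) = P i j"
    and rows: "\<And>k i. k < m \<Longrightarrow> i < n \<Longrightarrow> (\<Sum>j<n. P i j * S (k, j)) = S (k, i)"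
    and trace: "(\<Sum>i<n. P i i) \<le> real m" by blast
  \<comment> \<open>\<open>w\<close> is the residual of the new row after projection onto the span
    of the earlier ones, and \<open>q\<close> is its squared length.\<close>
  define w where "w i = S (m, i) - (\<Sum>j<n. P i j * S (m, j))" for i
  define q where "q = (\<Sum>i<n. (w i)\<^sup>2)"
  have Pw: "(\<Sum>j<n. P i j * w j) = 0" if "i < n" for i
  proof -
    have "(\<Sum>j<n. P i j * w j) = (\<Sum>j<n. P i j * S (m, j)) - (\<Sum>j<n. \<Sum>k<n. P i j * (P j k * S (m, k)))"
      by (simp add: w_def right_diff_distrib sum_subtractf sum_distrib_left)
    also have "(\<Sum>j<n. \<Sum>k<n. P i j * (P j k * S (m, k))) = (\<Sum>k<n. (\<Sum>j<n. P i j * P j k) * S (m, k))"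
      by (subst sum.swap) (simp add: sum_distrib_right mult.assoc)
    also have "\<dots> = (\<Sum>k<n. P i k * S (m, k))"
      using idem that by simp
    finally show ?thesis by simp
  qed
  \<comment> \<open>Since \<open>P\<close> is symmetric, \<open>P w = 0\<close> makes
    \<open>w\<close> orthogonal to the whole range of \<open>P\<close>, which contains the earlier
    rows.\<close>
  have orth: "(\<Sum>i<n. w i * (\<Sum>j<n. P i j * y j)) = 0" for y :: "nat \<Rightarrow> real"
  proof -
    have "(\<Sum>i<n. w i * (\<Sum>j<n. P i j * y j)) = (\<Sum>j<n. (\<Sum>i<n. P j i * w i) * y j)"
      by (simp add: sum_distrib_left sum_distrib_right)
         (subst sum.swap, simp add: sym mult_ac)
    also have "\<dots> = 0" using Pw by simp
    finally show ?thesis .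
  qed
  have w_row: "(\<Sum>i<n. w i * S (k, i)) = 0" if "k < m" for k
    using orth[of "\<lambda>j. S (k, j)"] rows[OF that] by simp
  \<comment> \<open>As \<open>w\<close> is orthogonal to the projection of the new row, its pairing
    with that row equals its pairing with itself.\<close>
  have w_new: "(\<Sum>i<n. w i * S (m, i)) = q"
  proof -
    have "q = (\<Sum>i<n. w i * S (m, i)) - (\<Sum>i<n. w i * (\<Sum>j<n. P i j * S (m, j)))"
      unfolding q_def by (simp add: power2_eq_square right_diff_distrib w_def flip: sum_subtractf)
    then show ?thesis using orth by simp
  qed
  show ?case
  proof (cases "q = 0")
    \<comment> \<open>A vanishing residual means that the new row is already fixed by
      \<open>P\<close>, so \<open>P\<close> itself serves.\<close>
    case True
    then have "w i = 0" if "i < n" for i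
      using that unfolding q_def by (simp add: sum_nonneg_eq_0_iff)
    then have "(\<Sum>j<n. P i j * S (m, j)) = S (m, i)" if "i < n" for i
      using that by (simp add: w_def)
    then show ?thesis
      using sym idem rows trace by (intro exI[of _ P]) (auto simp: less_Suc_eq)
  next
    case False
    \<comment> \<open>The added term is the projection onto the line through \<open>w\<close>; its
      trace is \<open>q / q = 1\<close>.\<close>
    define P' where "P' i j = P i j + w i * w j / q" for i j
    have P'_apply: "(\<Sum>j<n. P' i j * y j) = (\<Sum>j<n. P i j * y j) + w i * (\<Sum>j<n. w j * y j) / q"
      for i and y :: "nat \<Rightarrow> real"
      by (simp add: P'_def distrib_right sum.distrib sum_distrib_left sum_divide_distrib)
         (simp add: mult_ac)
    have sym': "P' i j = P' j i" for i j by (simp add: P'_def sym mult.commute)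
    have idem': "(\<Sum>k<n. P' i k * P' k j) = P' i j" if "i < n" "j < n" for i j
    proof -
      have "(\<Sum>k<n. P i k * P' k j) = P i j + (\<Sum>k<n. P i k * w k) * w j / q"
        using idem[OF that]
        by (simp add: P'_def distrib_left sum.distrib sum_distrib_left sum_distrib_right sum_divide_distrib mult_ac)
      moreover have "(\<Sum>k<n. w k * P' k j) = (\<Sum>k<n. P j k * w k) + w j"
      proof -
        have "(\<Sum>k<n. w k * P' k j) = (\<Sum>k<n. P' j k * w k)" by (simp add: sym'[of j] mult.commute)
        also have "\<dots> = (\<Sum>k<n. P j k * w k) + w j * q / q"
          unfolding P'_apply by (simp add: q_def power2_eq_square)
        finally show ?thesis using False by simp
      qed
      ultimately show ?thesis
        using that by (simp add: P'_apply[of i] Pw) (simp add: P'_def)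
    qed
    have "(\<Sum>i<n. P' i i) = (\<Sum>i<n. P i i) + q / q"
      by (simp add: P'_def sum.distrib q_def power2_eq_square flip: sum_divide_distrib)
    then have trace': "(\<Sum>i<n. P' i i) \<le> real (Suc m)" using trace False by simp
    have rows': "(\<Sum>j<n. P' i j * S (k, j)) = S (k, i)" if "k < Suc m" "i < n" for k i
    proof (cases "k = m")
      case True
      then show ?thesis using w_new False by (simp add: P'_apply) (simp add: w_def)
    next
      case False
      then show ?thesis using that w_row[of k] rows[of k] by (simp add: P'_apply)
    qed
    show ?thesis using sym' idem' rows' trace' by (intro exI[of _ P']) auto
  qed
qed

subsection \<open>Translated Gaussian vectors\<close>

abbreviation gaussian :: "nat \<Rightarrow> (nat \<Rightarrow> real) measure" where
  "gaussian n \<equiv> PiM {..<n} (\<lambda>_. std_normal_distribution)"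

lemma prob_space_std_normal: "prob_space std_normal_distribution"
  by (rule prob_space_normal_density) simp

lemma prob_space_gaussian: "prob_space (gaussian n)"
  by (intro prob_space_PiM prob_space_std_normal)

lemma sets_gaussian [measurable_cong]: "sets (gaussian n) = sets (vec_space n)"
  by (intro sets_PiM_cong) auto

lemma space_gaussian: "space (gaussian n) = space (vec_space n)"
  by (rule sets_eq_imp_space_eq[OF sets_gaussian])

lemma product_sigma_finite_std_normal: "product_sigma_finite (\<lambda>_. std_normal_distribution)"
  using prob_space_std_normal
  by (simp add: product_sigma_finite_def prob_space_imp_sigma_finite)

lemma normal_density_shift:
  "normal_density a 1 x = std_normal_density x * exp (a * x - a\<^sup>2 / 2)"
  by (simp add: normal_density_def mult_exp_exp power2_eq_square field_simps)

lemma std_normal_shift: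
  "distr std_normal_distribution borel (\<lambda>x. x + a) =
   density std_normal_distribution (\<lambda>x. ennreal (exp (a * x - a\<^sup>2 / 2)))"
proof -
  interpret N: prob_space std_normal_distribution by (rule prob_space_std_normal)
  have "distributed std_normal_distribution lborel (\<lambda>x. x) std_normal_density"
    by (simp add: distributed_def distr_id2)
  then have "distributed std_normal_distribution lborel (\<lambda>x. a + 1 * x) (normal_density (a + 1 * 0) (\<bar>1\<bar> * 1))"
    by (intro N.normal_density_affine) auto
  then have "distr std_normal_distribution lborel (\<lambda>x. x + a) = density lborel (normal_density a 1)"
    by (simp add: distributed_def add.commute)
  moreover have "distr std_normal_distribution lborel (\<lambda>x. x + a) = distr std_normal_distribution borel (\<lambda>x. x + a)"
    by (intro distr_cong) auto
  moreover have "density lborel (normal_density a 1) = density std_normal_distribution (\<lambda>x. ennreal (exp (a * x - a\<^sup>2 / 2)))"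
    by (subst density_density_eq) (auto simp: normal_density_shift[of a] ennreal_mult'' intro!: density_cong)
  ultimately show ?thesis by simp
qed

text \<open>The restriction keeps the result extensional, hence a point of
  \<open>vec_space n\<close>.\<close>

definition translate :: "nat \<Rightarrow> (nat \<Rightarrow> real) \<Rightarrow> (nat \<Rightarrow> real) \<Rightarrow> nat \<Rightarrow> real" where
  "translate n v x = (\<lambda>i\<in>{..<n}. x i + v i)"

lemma measurable_translate [measurable]: "translate n v \<in> vec_space n \<rightarrow>\<^sub>M vec_space n"
  unfolding translate_def by measurable

text \<open>This is the likelihood ratio of the Gaussian with mean \<open>v\<close> and identity
  covariance against the standard one: the exponential of the inner product of \<open>v\<close> and
  \<open>x\<close> minus half the squared length of \<open>v\<close>.\<close>

definition gauss_ratio :: "nat \<Rightarrow> (nat \<Rightarrow> real) \<Rightarrow> (nat \<Rightarrow> real) \<Rightarrow> real" where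
  "gauss_ratio n v x = exp (\<Sum>i<n. v i * x i - (v i)\<^sup>2 / 2)"

lemma measurable_gauss_ratio [measurable]: "gauss_ratio n v \<in> borel_measurable (vec_space n)"
  unfolding gauss_ratio_def by measurable

text \<open>Both sides equal the product of the one-dimensional tilted measures \<open>?M i\<close>,
  because they agree with it on boxes: the density factors over coordinates, and the preimage of a
  box under a translation is a box.\<close>

lemma gaussian_shift:
  "distr (gaussian n) (vec_space n) (translate n v) = density (gaussian n) (\<lambda>x. ennreal (gauss_ratio n v x))"
proof -
  let ?N = "std_normal_distribution"
  let ?M = "\<lambda>i. density ?N (\<lambda>x. ennreal (exp (v i * x - (v i)\<^sup>2 / 2)))"
  interpret G: product_sigma_finite "\<lambda>_::nat. ?N" by (rule product_sigma_finite_std_normal)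
  have "prob_space (?M i)" for i
    unfolding std_normal_shift[symmetric]
    by (intro prob_space.prob_space_distr prob_space_std_normal) simp
  then interpret M: product_sigma_finite ?M
    by (simp add: product_sigma_finite_def prob_space_imp_sigma_finite)
  have sets_M: "sets (PiM {..<n} ?M) = sets (vec_space n)"
    by (intro sets_PiM_cong) auto
  have "PiM {..<n} ?M = density (gaussian n) (\<lambda>x. ennreal (gauss_ratio n v x))"
  proof (rule M.PiM_eqI[symmetric])
    fix A assume "\<And>i. i \<in> {..<n} \<Longrightarrow> A i \<in> sets (?M i)"
    then have A: "\<And>i. i \<in> {..<n} \<Longrightarrow> A i \<in> sets borel" by simp
    have PA: "Pi\<^sub>E {..<n} A \<in> sets (gaussian n)"
      using A by (intro sets_PiM_I_finite) auto
    have "emeasure (density (gaussian n) (\<lambda>x. ennreal (gauss_ratio n v x))) (Pi\<^sub>E {..<n} A)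
        = (\<integral>\<^sup>+x. ennreal (gauss_ratio n v x) * indicator (Pi\<^sub>E {..<n} A) x \<partial>gaussian n)"
      by (intro emeasure_density PA) measurable
    also have "\<dots> = (\<integral>\<^sup>+x. (\<Prod>i<n. ennreal (exp (v i * x i - (v i)\<^sup>2 / 2)) * indicator (A i) (x i)) \<partial>gaussian n)"
    proof (intro nn_integral_cong)
      fix x assume "x \<in> space (gaussian n)"
      then have "indicator (Pi\<^sub>E {..<n} A) x = (\<Prod>i<n. indicator (A i) (x i) :: ennreal)"
        by (auto simp: indicator_def space_PiM PiE_iff prod_eq_1_iff)
      then show "ennreal (gauss_ratio n v x) * indicator (Pi\<^sub>E {..<n} A) x =
          (\<Prod>i<n. ennreal (exp (v i * x i - (v i)\<^sup>2 / 2)) * indicator (A i) (x i))"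
        by (simp add: gauss_ratio_def exp_sum prod.distrib prod_ennreal)
    qed
    also have "\<dots> = (\<Prod>i<n. \<integral>\<^sup>+x. ennreal (exp (v i * x - (v i)\<^sup>2 / 2)) * indicator (A i) x \<partial>?N)"
      using A by (intro G.product_nn_integral_prod) (auto intro!: borel_measurable_times_ennreal borel_measurable_indicator)
    also have "\<dots> = (\<Prod>i<n. emeasure (?M i) (A i))"
      using A by (intro prod.cong refl emeasure_density[symmetric]) auto
    finally show "emeasure (density (gaussian n) (\<lambda>x. ennreal (gauss_ratio n v x))) (Pi\<^sub>E {..<n} A) = (\<Prod>i<n. emeasure (?M i) (A i))" .
  qed (use sets_M sets_gaussian in auto)
  moreover have "PiM {..<n} ?M = distr (gaussian n) (vec_space n) (translate n v)"
  proof (rule M.PiM_eqI[symmetric])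
    fix A assume "\<And>i. i \<in> {..<n} \<Longrightarrow> A i \<in> sets (?M i)"
    then have A: "\<And>i. i \<in> {..<n} \<Longrightarrow> A i \<in> sets borel" by simp
    have PA: "Pi\<^sub>E {..<n} A \<in> sets (vec_space n)"
      using A by (intro sets_PiM_I_finite) auto
    have "emeasure (distr (gaussian n) (vec_space n) (translate n v)) (Pi\<^sub>E {..<n} A)
        = emeasure (gaussian n) (translate n v -` Pi\<^sub>E {..<n} A \<inter> space (gaussian n))"
      by (intro emeasure_distr PA) measurable
    also have "translate n v -` Pi\<^sub>E {..<n} A \<inter> space (gaussian n) = Pi\<^sub>E {..<n} (\<lambda>i. (\<lambda>x. x + v i) -` A i)"
      by (auto simp: translate_def space_PiM PiE_iff)
    also have "emeasure (gaussian n) \<dots> = (\<Prod>i<n. emeasure ?N ((\<lambda>x. x + v i) -` A i))"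
    proof (intro G.emeasure_PiM)
      fix i assume "i \<in> {..<n}"
      have "(\<lambda>x. x + v i) -` A i \<inter> space borel \<in> sets borel"
        using A[OF \<open>i \<in> {..<n}\<close>] by (intro measurable_sets[where A=borel]) auto
      then show "(\<lambda>x. x + v i) -` A i \<in> sets ?N" by simp
    qed simp
    also have "\<dots> = (\<Prod>i<n. emeasure (?M i) (A i))"
      using A unfolding std_normal_shift[symmetric]
      by (intro prod.cong refl) (simp add: emeasure_distr)
    finally show "emeasure (distr (gaussian n) (vec_space n) (translate n v)) (Pi\<^sub>E {..<n} A) = (\<Prod>i<n. emeasure (?M i) (A i))" .
  qed (use sets_M in auto)
  ultimately show ?thesis by simp
qed

lemma integral_gaussian_shift:
  fixes f :: "(nat \<Rightarrow> real) \<Rightarrow> real"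
  assumes [measurable]: "f \<in> borel_measurable (vec_space n)"
  shows "(\<integral>x. f (translate n v x) \<partial>gaussian n) = (\<integral>x. gauss_ratio n v x * f x \<partial>gaussian n)"
proof -
  have "(\<integral>x. f (translate n v x) \<partial>gaussian n) = (\<integral>x. f x \<partial>distr (gaussian n) (vec_space n) (translate n v))"
    by (rule integral_distr[symmetric]) measurable
  also have "\<dots> = (\<integral>x. gauss_ratio n v x *\<^sub>R f x \<partial>gaussian n)"
    unfolding gaussian_shift by (rule integral_density) (auto simp: gauss_ratio_def)
  finally show ?thesis by simp
qed

lemma integral_gauss_ratio: "(\<integral>x. gauss_ratio n v x \<partial>gaussian n) = 1"
  using integral_gaussian_shift[of "\<lambda>_. 1" n v] prob_space.prob_space[OF prob_space_gaussian, of n]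
  by simp

text \<open>The Bochner integral of a function that is not integrable is 0, so the value 1 forces
  integrability.\<close>

lemma integrable_gauss_ratio: "integrable (gaussian n) (gauss_ratio n v)"
  using integral_gauss_ratio[of n v] not_integrable_integral_eq by fastforce

text \<open>Le Cam's two-point bound, where the affinity of two unit Gaussians at distance \<open>s\<close> is
  \<open>exp (- s\<^sup>2 / 8)\<close>.\<close>

lemma gaussian_two_point:
  fixes f :: "(nat \<Rightarrow> real) \<Rightarrow> real"
  assumes f[measurable]: "f \<in> borel_measurable (vec_space n)"
    and f01: "\<And>x. x \<in> space (vec_space n) \<Longrightarrow> 0 \<le> f x \<and> f x \<le> 1"
  shows "(\<integral>x. f x \<partial>gaussian n) + (\<integral>x. 1 - f (translate n v x) \<partial>gaussian n)
     \<ge> exp (- (\<Sum>i<n. (v i)\<^sup>2) / 4) / 2"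
proof -
  interpret G: prob_space "gaussian n" by (rule prob_space_gaussian)
  define s where "s = (\<Sum>i<n. (v i)\<^sup>2)"
  \<comment> \<open>\<open>a\<close> is half the affinity \<open>A = exp (- s / 8)\<close>. This
    maximises \<open>2 * a * A - 2 * a^2\<close>, the integral of the pointwise lower bound below,
    and the maximum is \<open>A^2 / 2\<close>.\<close>
  define a where "a = exp (- s / 8) / 2"
  let ?L = "gauss_ratio n v" and ?h = "gauss_ratio n (\<lambda>i. v i / 2)"
  have sp: "space (gaussian n) = space (vec_space n)" by (rule space_gaussian)
  \<comment> \<open>The square root of the likelihood ratio for \<open>v\<close> is a constant times
    the ratio for \<open>v / 2\<close>. As the latter integrates to 1, the constant is the
    affinity.\<close>
  have sqrt_L: "exp (- s / 8) * ?h x = sqrt (?L x)" for x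
  proof -
    have "exp (- s / 8) * ?h x = exp (- s / 8 + (\<Sum>i<n. v i / 2 * x i - (v i / 2)\<^sup>2 / 2))"
      by (simp only: gauss_ratio_def exp_add)
    also have "- s / 8 + (\<Sum>i<n. v i / 2 * x i - (v i / 2)\<^sup>2 / 2) = (\<Sum>i<n. v i * x i - (v i)\<^sup>2 / 2) / 2"
    proof -
      have "(\<Sum>i<n. v i / 2 * x i - (v i / 2)\<^sup>2 / 2) = (\<Sum>i<n. (v i * x i - (v i)\<^sup>2 / 2) / 2 + (v i)\<^sup>2 / 8)"
        by (intro sum.cong refl) (simp add: power2_eq_square field_simps)
      then show ?thesis by (simp add: s_def sum.distrib flip: sum_divide_distrib)
    qed
    finally have e: "exp (- s / 8) * ?h x = exp ((\<Sum>i<n. v i * x i - (v i)\<^sup>2 / 2) / 2)" .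
    have "?L x = (exp ((\<Sum>i<n. v i * x i - (v i)\<^sup>2 / 2) / 2))\<^sup>2"
      by (simp add: gauss_ratio_def flip: exp_double)
    then show ?thesis unfolding e by simp
  qed
  have L_pos: "?L x > 0" for x by (simp add: gauss_ratio_def)
  have f_int: "integrable (gaussian n) f"
    using f01 by (intro G.integrable_const_bound[where B=1]) (auto simp: sp)
  have Lf_int: "integrable (gaussian n) (\<lambda>x. ?L x * (1 - f x))"
  proof (rule Bochner_Integration.integrable_bound[OF integrable_gauss_ratio[of n v]])
    show "AE x in gaussian n. norm (?L x * (1 - f x)) \<le> norm (?L x)"
      using f01 by (intro AE_I2) (auto simp: sp abs_mult intro!: mult_left_le)
  qed measurable
  \<comment> \<open>A linearised form of the Cauchy-Schwarz step: the sum of the two error densities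
    is at least \<open>min 1 (?L x)\<close>, and this dominates an expression in \<open>?L x\<close>
    and its square root whose integral is known.\<close>
  have "2 * a * (exp (- s / 8) * ?h x) - a\<^sup>2 * (1 + ?L x) \<le> f x + ?L x * (1 - f x)"
    if "x \<in> space (gaussian n)" for x
  proof -
    have r: "?L x = (sqrt (?L x))\<^sup>2" using L_pos[of x] by simp
    define y where "y = sqrt (?L x)"
    have y: "?L x = y\<^sup>2" "exp (- s / 8) * ?h x = y" "y > 0"
      using r sqrt_L L_pos[of x] by (simp_all add: y_def)
    have fx: "0 \<le> f x" "f x \<le> 1" using f01 that by (auto simp: sp)
    \<comment> \<open>The right side is a convex combination of 1 and \<open>y^2\<close>.\<close>
    have "min 1 (y\<^sup>2) \<le> f x + y\<^sup>2 * (1 - f x)"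
    proof -
      have "f x * min 1 (y\<^sup>2) + (1 - f x) * min 1 (y\<^sup>2) \<le> f x * 1 + (1 - f x) * y\<^sup>2"
        using fx by (intro add_mono mult_left_mono) auto
      then show ?thesis by (simp add: algebra_simps)
    qed
    moreover have "2 * a * y - a\<^sup>2 * (1 + y\<^sup>2) \<le> min 1 (y\<^sup>2)"
    proof -
      have "2 * a * y \<le> 1 + a\<^sup>2 * y\<^sup>2" "2 * a * y \<le> y\<^sup>2 + a\<^sup>2"
        using sum_squares_bound[of 1 "a * y"] sum_squares_bound[of a y] by (simp_all add: power_mult_distrib)
      moreover have "0 \<le> a\<^sup>2" "0 \<le> a\<^sup>2 * y\<^sup>2" by simp_all
      ultimately show ?thesis unfolding distrib_left by - (rule min.boundedI; linarith)
    qed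
    ultimately show ?thesis unfolding y by linarith
  qed
  then have "(\<integral>x. 2 * a * (exp (- s / 8) * ?h x) - a\<^sup>2 * (1 + ?L x) \<partial>gaussian n)
      \<le> (\<integral>x. f x + ?L x * (1 - f x) \<partial>gaussian n)"
    using f_int Lf_int integrable_gauss_ratio
    by (intro integral_mono) (auto intro!: integrable_diff integrable_mult_right integrable_add)
  also have "\<dots> = (\<integral>x. f x \<partial>gaussian n) + (\<integral>x. ?L x * (1 - f x) \<partial>gaussian n)"
    using f_int Lf_int by simp
  also have "(\<integral>x. ?L x * (1 - f x) \<partial>gaussian n) = (\<integral>x. 1 - f (translate n v x) \<partial>gaussian n)"
    by (rule integral_gaussian_shift[symmetric]) measurable
  also have "(\<integral>x. 2 * a * (exp (- s / 8) * ?h x) - a\<^sup>2 * (1 + ?L x) \<partial>gaussian n)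
      = 2 * a * exp (- s / 8) - 2 * a\<^sup>2"
    using integrable_gauss_ratio by (simp add: integral_gauss_ratio G.prob_space)
  also have "\<dots> = exp (- s / 4) / 2"
    by (simp add: a_def power2_eq_square mult_exp_exp)
  finally show ?thesis by (simp add: s_def)
qed

subsection \<open>Gaussian tails\<close>

text \<open>The weight turns the standard density into \<sigma> times the density of the centred
  Gaussian with standard deviation \<sigma>. The parametrisation by \<sigma> covers positive
  exponents (\<sigma> > 1) and negative ones (\<sigma> < 1) alike.\<close>

lemma integral_std_normal_exp_square:
  fixes \<sigma> :: real
  assumes "\<sigma> > 0"
  shows "(\<integral>\<^sup>+x. ennreal (exp ((1 - 1 / \<sigma>\<^sup>2) / 2 * x\<^sup>2)) \<partial>std_normal_distribution) = ennreal \<sigma>"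
proof -
  have eq: "std_normal_density x * exp ((1 - 1 / \<sigma>\<^sup>2) / 2 * x\<^sup>2) = \<sigma> * normal_density 0 \<sigma> x" for x
    using assms by (simp add: normal_density_def mult_exp_exp real_sqrt_mult field_simps)
  have "(\<integral>\<^sup>+x. ennreal (exp ((1 - 1 / \<sigma>\<^sup>2) / 2 * x\<^sup>2)) \<partial>std_normal_distribution)
      = (\<integral>\<^sup>+x. ennreal (\<sigma> * normal_density 0 \<sigma> x) \<partial>lborel)"
    by (subst nn_integral_density) (simp_all add: eq[unfolded times_divide_eq_left] flip: ennreal_mult)
  also have "\<dots> = ennreal (\<integral>x. \<sigma> * normal_density 0 \<sigma> x \<partial>lborel)"
    using assms by (intro nn_integral_eq_integral) auto
  finally show ?thesis using assms by simp
qed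

text \<open>Markov's inequality for the exponential of the weighted sum of squares; by independence
  each coordinate in \<open>J\<close> contributes a factor \<sigma>. Taking \<sigma> > 1 bounds
  upper tails, and \<sigma> < 1, where the weight is negative, bounds lower tails.\<close>

lemma gaussian_chernoff:
  fixes \<sigma> :: real
  assumes "\<sigma> > 0" and J: "J \<subseteq> {..<n}"
  shows "measure (gaussian n) {x \<in> space (gaussian n). (1 - 1 / \<sigma>\<^sup>2) / 2 * (\<Sum>i\<in>J. (x i)\<^sup>2) \<ge> b}
    \<le> \<sigma> ^ card J * exp (- b)"
proof -
  interpret G: prob_space "gaussian n" by (rule prob_space_gaussian)
  interpret P: product_sigma_finite "\<lambda>_::nat. std_normal_distribution" by (rule product_sigma_finite_std_normal)
  define \<kappa> where "\<kappa> = (1 - 1 / \<sigma>\<^sup>2) / 2"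
  let ?A = "{x \<in> space (gaussian n). \<kappa> * (\<Sum>i\<in>J. (x i)\<^sup>2) \<ge> b}"
  have Jm [measurable]: "(\<lambda>x. \<Sum>i\<in>J. (x i)\<^sup>2) \<in> borel_measurable (vec_space n)"
    using J by (intro borel_measurable_sum borel_measurable_power measurable_component_singleton) auto
  have "emeasure (gaussian n) ?A \<le> (\<integral>\<^sup>+x. ennreal (exp (- b)) * ennreal (exp (\<kappa> * (\<Sum>i\<in>J. (x i)\<^sup>2))) \<partial>gaussian n)"
  proof -
    have "emeasure (gaussian n) ?A = (\<integral>\<^sup>+x. indicator ?A x \<partial>gaussian n)"
      by (intro nn_integral_indicator[symmetric]) measurable
    also have "\<dots> \<le> (\<integral>\<^sup>+x. ennreal (exp (- b)) * ennreal (exp (\<kappa> * (\<Sum>i\<in>J. (x i)\<^sup>2))) \<partial>gaussian n)"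
      by (intro nn_integral_mono)
         (auto simp: indicator_def mult_exp_exp simp flip: ennreal_mult ennreal_1 intro!: ennreal_leI)
    finally show ?thesis .
  qed
  also have "\<dots> = ennreal (exp (- b)) * (\<integral>\<^sup>+x. ennreal (exp (\<kappa> * (\<Sum>i\<in>J. (x i)\<^sup>2))) \<partial>gaussian n)"
    by (intro nn_integral_cmult) measurable
  \<comment> \<open>Coordinates outside \<open>J\<close> receive the factor 1, so that the product
    runs over all coordinates of the product measure.\<close>
  also have "(\<integral>\<^sup>+x. ennreal (exp (\<kappa> * (\<Sum>i\<in>J. (x i)\<^sup>2))) \<partial>gaussian n)
      = (\<integral>\<^sup>+x. (\<Prod>i<n. if i \<in> J then ennreal (exp (\<kappa> * (x i)\<^sup>2)) else 1) \<partial>gaussian n)"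
  proof (intro nn_integral_cong)
    fix x :: "nat \<Rightarrow> real"
    have fJ: "finite J" using J finite_subset by blast
    have "(\<Prod>i<n. if i \<in> J then ennreal (exp (\<kappa> * (x i)\<^sup>2)) else 1) = (\<Prod>i\<in>J. ennreal (exp (\<kappa> * (x i)\<^sup>2)))"
      using J by (simp add: Int_absorb1 flip: prod.inter_restrict)
    then show "ennreal (exp (\<kappa> * (\<Sum>i\<in>J. (x i)\<^sup>2))) = (\<Prod>i<n. if i \<in> J then ennreal (exp (\<kappa> * (x i)\<^sup>2)) else 1)"
      using fJ by (simp add: sum_distrib_left exp_sum prod_ennreal)
  qed
  also have "\<dots> = (\<Prod>i<n. \<integral>\<^sup>+x. (if i \<in> J then ennreal (exp (\<kappa> * x\<^sup>2)) else 1) \<partial>std_normal_distribution)"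
    by (intro P.product_nn_integral_prod) auto
  also have "\<dots> = (\<Prod>i<n. if i \<in> J then ennreal \<sigma> else 1)"
  proof (intro prod.cong refl)
    fix i
    show "(\<integral>\<^sup>+x. (if i \<in> J then ennreal (exp (\<kappa> * x\<^sup>2)) else 1) \<partial>std_normal_distribution)
        = (if i \<in> J then ennreal \<sigma> else 1)"
      using integral_std_normal_exp_square[OF \<open>\<sigma> > 0\<close>] prob_space.emeasure_space_1[OF prob_space_std_normal]
      by (simp add: \<kappa>_def)
  qed
  also have "\<dots> = ennreal (\<sigma> ^ card J)"
    using J assms(1) by (simp add: Int_absorb1 ennreal_power flip: prod.inter_restrict)
  finally have "emeasure (gaussian n) ?A \<le> ennreal (\<sigma> ^ card J * exp (- b))"
    using assms(1) by (simp add: mult.commute flip: ennreal_mult)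
  then show ?thesis
    using assms(1) by (simp add: G.emeasure_eq_measure \<kappa>_def)
qed

text \<open>For \<sigma> = 2 the weight in the Chernoff bound is \<open>3 / 8\<close>.\<close>

lemma gaussian_coordinate_tail:
  assumes "i < n"
  shows "measure (gaussian n) {x \<in> space (gaussian n). (x i)\<^sup>2 \<ge> b} \<le> 2 * exp (- (3 / 8 * b))"
  using gaussian_chernoff[of 2 "{i}" n "3 / 8 * b"] assms by simp

text \<open>With \<sigma> = 2 the exponent is \<open>3 / 8 * 4 * n = 3 / 2 * n\<close>, and the
  factor \<open>2 ^ n\<close> is absorbed through \<open>2 \<le> exp 1\<close>.\<close>

lemma gaussian_norm_upper_tail:
  "measure (gaussian n) {x \<in> space (gaussian n). (\<Sum>i<n. (x i)\<^sup>2) \<ge> 4 * real n} \<le> exp (- (real n / 2))"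
proof -
  have "measure (gaussian n) {x \<in> space (gaussian n). (\<Sum>i<n. (x i)\<^sup>2) \<ge> 4 * real n} \<le> 2 ^ n * exp (- (3 / 2 * real n))"
    using gaussian_chernoff[of 2 "{..<n}" n "3 / 2 * real n"] by (simp add: mult.commute)
  also have "\<dots> \<le> exp 1 ^ n * exp (- (3 / 2 * real n))"
    using exp_ge_add_one_self[of 1] by (intro mult_right_mono power_mono) auto
  also have "\<dots> = exp (- (real n / 2))"
    by (simp add: mult_exp_exp flip: exp_of_nat_mult)
  finally show ?thesis .
qed

text \<open>With \<sigma> = 1/2 the weight is \<open>- 3 / 2\<close>, which reverses the inequality.
  The gain \<open>(1 / 2) ^ n\<close> beats \<open>exp (3 / 8 * n)\<close> because
  \<open>1 / 2 \<le> exp (- 1 / 2)\<close>, that is, because e \<le> 4.\<close>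

lemma gaussian_norm_lower_tail:
  "measure (gaussian n) {x \<in> space (gaussian n). (\<Sum>i<n. (x i)\<^sup>2) \<le> real n / 4} \<le> exp (- (real n / 8))"
proof -
  have "measure (gaussian n) {x \<in> space (gaussian n). (\<Sum>i<n. (x i)\<^sup>2) \<le> real n / 4} \<le> (1 / 2) ^ n * exp (3 / 8 * real n)"
    using gaussian_chernoff[of "1 / 2" "{..<n}" n "- (3 / 8) * real n"]
    by (simp add: mult.commute power2_eq_square)
  also have "(1 / 2 :: real) \<le> exp (- 1 / 2)"
  proof -
    have "exp (1 / 2 :: real) * exp (1 / 2) = exp 1" by (simp add: mult_exp_exp)
    moreover have "exp (1::real) \<le> 2 * 2" using exp_le by simp
    ultimately have "exp (1 / 2 :: real) \<le> 2"
      by (metis abs_le_square_iff abs_numeral abs_exp_cancel power2_eq_square)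
    then show ?thesis by (simp add: exp_minus field_simps)
  qed
  then have "(1 / 2) ^ n * exp (3 / 8 * real n) \<le> exp (- 1 / 2) ^ n * exp (3 / 8 * real n)"
    by (intro mult_right_mono power_mono) auto
  also have "\<dots> = exp (- (real n / 8))"
    by (simp add: mult_exp_exp flip: exp_of_nat_mult)
  finally show ?thesis .
qed

subsection \<open>Planted heavy hitters\<close>

abbreviation spike :: "nat \<Rightarrow> real \<Rightarrow> nat \<Rightarrow> real" where
  "spike i t \<equiv> (\<lambda>j. if j = i then t else 0)"

lemma L2_set_squared: "(L2_set x A)\<^sup>2 = (\<Sum>i\<in>A. (x i)\<^sup>2)"
  by (simp add: L2_set_def sum_nonneg)

text \<open>The two thresholds match: \<open>\<epsilon> * n / 8\<close> is \<epsilon>/2 times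
  \<open>n / 4\<close>.\<close>

lemma not_heavy_hitter:
  assumes "0 < \<epsilon>" and "(x i)\<^sup>2 < \<epsilon> * real n / 8" and "real n / 4 < (\<Sum>j<n. (x j)\<^sup>2)"
  shows "i \<notin> heavy_hitters n (\<epsilon> / 2) x"
proof -
  have "\<epsilon> / 2 * (real n / 4) < \<epsilon> / 2 * (\<Sum>j<n. (x j)\<^sup>2)"
    using assms by (intro mult_strict_left_mono) auto
  then have "(x i)\<^sup>2 < \<epsilon> / 2 * (\<Sum>j<n. (x j)\<^sup>2)" using assms(2) by linarith
  then show ?thesis unfolding heavy_hitters_def L2_set_squared by auto
qed

text \<open>Put \<open>B = \<epsilon> * n / 8\<close>. The spike has height
  \<open>10 * sqrt B\<close> and the noise at \<open>i\<close> is at most \<open>sqrt B\<close>, so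
  the square there is at least \<open>81 * B\<close>. The squared norm is at most
  \<open>8 * n + 200 * B\<close>; times \<epsilon> this is at most \<open>64 * B + 2 * B\<close>,
  where \<epsilon> < 1/100 bounds the second term.\<close>

lemma spike_heavy_hitter:
  assumes "0 < \<epsilon>" "\<epsilon> < 1 / 100" "i < n"
    and xi: "(x i)\<^sup>2 < \<epsilon> * real n / 8" and norm: "(\<Sum>j<n. (x j)\<^sup>2) < 4 * real n"
  shows "i \<in> heavy_hitters n \<epsilon> (translate n (spike i (10 * sqrt (\<epsilon> * real n / 8))) x)"
proof -
  define B where "B = \<epsilon> * real n / 8"
  define t where "t = 10 * sqrt B"
  have B: "B \<ge> 0" and t2: "t\<^sup>2 = 100 * B"
    using assms by (simp_all add: B_def t_def power_mult_distrib)
  have "\<bar>x i\<bar> \<le> sqrt B"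
    using xi by (simp add: B_def real_le_rsqrt)
  then have "9 * sqrt B \<le> x i + t" by (simp add: t_def abs_le_iff)
  then have "(9 * sqrt B)\<^sup>2 \<le> (x i + t)\<^sup>2" using B by (intro power_mono) auto
  then have lhs: "81 * B \<le> (x i + t)\<^sup>2" using B by (simp add: power_mult_distrib)
  have "(\<Sum>j<n. (translate n (spike i t) x j)\<^sup>2) \<le> (\<Sum>j<n. 2 * (x j)\<^sup>2 + (if j = i then 2 * t\<^sup>2 else 0))"
  proof (intro sum_mono)
    fix j assume "j \<in> {..<n}"
    then have "(translate n (spike i t) x j)\<^sup>2 = (x j + spike i t j)\<^sup>2" by (simp add: translate_def)
    moreover have "(x j + spike i t j)\<^sup>2 \<le> 2 * (x j)\<^sup>2 + 2 * (spike i t j)\<^sup>2"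
      using sum_squares_bound[of "x j" "spike i t j"] unfolding power2_sum by linarith
    ultimately show "(translate n (spike i t) x j)\<^sup>2 \<le> 2 * (x j)\<^sup>2 + (if j = i then 2 * t\<^sup>2 else 0)"
      by (auto split: if_splits)
  qed
  also have "\<dots> = 2 * (\<Sum>j<n. (x j)\<^sup>2) + 2 * t\<^sup>2"
    using \<open>i < n\<close> by (simp add: sum.distrib sum_distrib_left)
  also have "\<dots> \<le> 8 * real n + 200 * B"
    using norm t2 by simp
  finally have "\<epsilon> * (\<Sum>j<n. (translate n (spike i t) x j)\<^sup>2) \<le> \<epsilon> * (8 * real n + 200 * B)"
    using \<open>0 < \<epsilon>\<close> by (intro mult_left_mono) auto
  also have "\<dots> = 64 * B + (100 * \<epsilon>) * (2 * B)" by (simp add: B_def algebra_simps)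
  also have "\<dots> \<le> 64 * B + 1 * (2 * B)"
    using assms B by (intro add_left_mono mult_right_mono) auto
  also have "\<dots> \<le> 81 * B" using B by simp
  finally have "i \<in> heavy_hitters n \<epsilon> (translate n (spike i t) x)"
    using lhs \<open>i < n\<close> unfolding heavy_hitters_def L2_set_squared by (simp add: translate_def)
  then show ?thesis unfolding t_def B_def .
qed

section \<open>Testing from the sketch of a fixed matrix\<close>

lemma measurable_mat_vec [measurable]:
  "(\<lambda>p. mat_vec m n (fst p) (snd p)) \<in> mat_space m n \<Otimes>\<^sub>M vec_space n \<rightarrow>\<^sub>M vec_space m"
  unfolding mat_vec_def by measurable

lemma measurable_mat_vec_fixed [measurable]:
  "mat_vec m n S \<in> vec_space n \<rightarrow>\<^sub>M vec_space m"
  unfolding mat_vec_def by measurable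

text \<open>For a fixed \<open>S\<close> the test at \<open>i\<close> sees the spike only through
  its projection to the row space, so the two-point bound applies with the shorter shift. The
  projected lengths have bounded sum, and convexity of \<open>exp\<close> turns this into a bound on
  the total error.\<close>

lemma sketch_indistinguishable:
  fixes f :: "nat \<Rightarrow> (nat \<Rightarrow> real) \<Rightarrow> real"
  assumes [measurable]: "\<And>i. f i \<in> borel_measurable (vec_space m)"
    and f01: "\<And>i y. y \<in> space (vec_space m) \<Longrightarrow> 0 \<le> f i y \<and> f i y \<le> 1"
    and "n > 0"
  shows "real n * (exp (- (t\<^sup>2 * real m / (4 * real n))) / 2) \<le>
    (\<Sum>i<n. (\<integral>x. f i (mat_vec m n S x) \<partial>gaussian n) +
            (\<integral>x. 1 - f i (mat_vec m n S (translate n (spike i t) x)) \<partial>gaussian n))"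
proof -
  obtain P :: "nat \<Rightarrow> nat \<Rightarrow> real" where sym: "\<And>i j. P i j = P j i"
    and idem: "\<And>i j. i < n \<Longrightarrow> j < n \<Longrightarrow> (\<Sum>k<n. P i k * P k j) = P i j"
    and rows: "\<And>k i. k < m \<Longrightarrow> i < n \<Longrightarrow> (\<Sum>j<n. P i j * S (k, j)) = S (k, i)"
    and trace: "(\<Sum>i<n. P i i) \<le> real m"
    using row_space_projection[of n m S] by blast
  \<comment> \<open>\<open>P\<close> fixes the rows of \<open>S\<close>, so a unit vector and its
    projection have the same sketch.\<close>
  have same_sketch: "mat_vec m n S (translate n (spike i t) x) = mat_vec m n S (translate n (\<lambda>j. t * P i j) x)"
    if "i < n" for i x
  proof -
    have "(\<Sum>j<n. S (k, j) * (x j + spike i t j)) = (\<Sum>j<n. S (k, j) * (x j + t * P i j))" if "k < m" for k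
    proof -
      have "(\<Sum>j<n. S (k, j) * spike i t j) = t * S (k, i)"
        using \<open>i < n\<close> by (simp add: if_distrib cong: if_cong)
      also have "\<dots> = (\<Sum>j<n. S (k, j) * (t * P i j))"
        by (subst rows[OF that \<open>i < n\<close>, symmetric]) (simp add: sum_distrib_left mult_ac)
      finally show ?thesis by (simp add: distrib_left sum.distrib)
    qed
    then show ?thesis by (auto simp: mat_vec_def translate_def intro!: restrict_ext)
  qed
  \<comment> \<open>For a symmetric idempotent matrix the squared length of row \<open>i\<close> is
    the diagonal entry.\<close>
  have P_norm: "(\<Sum>j<n. (t * P i j)\<^sup>2) = t\<^sup>2 * P i i" if "i < n" for i
  proof -
    have "(\<Sum>k<n. P i k * P k i) = (\<Sum>j<n. (P i j)\<^sup>2)"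
      by (intro sum.cong refl) (metis power2_eq_square sym)
    then show ?thesis
      using idem[OF that that] by (simp add: power_mult_distrib flip: sum_distrib_left)
  qed
  have "exp (- (t\<^sup>2 * real m / (4 * real n))) \<le> exp (\<Sum>i<n. (1 / real n) *\<^sub>R (- (t\<^sup>2 * P i i) / 4))"
  proof -
    have "(\<Sum>i<n. (1 / real n) *\<^sub>R (- (t\<^sup>2 * P i i) / 4)) = - (t\<^sup>2 * (\<Sum>i<n. P i i) / (4 * real n))"
      by (simp add: sum_distrib_left sum_divide_distrib sum_negf mult_ac)
    then show ?thesis using trace by (simp add: divide_right_mono mult_left_mono)
  qed
  \<comment> \<open>Jensen's inequality for \<open>exp\<close> with uniform weights over the
    coordinates.\<close>
  also have "\<dots> \<le> (\<Sum>i<n. (1 / real n) * exp (- (t\<^sup>2 * P i i) / 4))"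
    using \<open>n > 0\<close> by (intro convex_on_sum[OF _ _ exp_convex]) auto
  finally have "real n * (exp (- (t\<^sup>2 * real m / (4 * real n))) / 2)
      \<le> real n * ((\<Sum>i<n. (1 / real n) * exp (- (t\<^sup>2 * P i i) / 4)) / 2)"
    by (intro mult_left_mono divide_right_mono) auto
  also have "\<dots> = (\<Sum>i<n. exp (- (t\<^sup>2 * P i i) / 4) / 2)"
    using \<open>n > 0\<close> by (simp add: sum_distrib_left sum_divide_distrib)
  also have "\<dots> \<le> (\<Sum>i<n. (\<integral>x. f i (mat_vec m n S x) \<partial>gaussian n) +
            (\<integral>x. 1 - f i (mat_vec m n S (translate n (spike i t) x)) \<partial>gaussian n))"
  proof (intro sum_mono)
    fix i assume "i \<in> {..<n}"
    then have i: "i < n" by simp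
    have "exp (- (\<Sum>j<n. (t * P i j)\<^sup>2) / 4) / 2 \<le> (\<integral>x. f i (mat_vec m n S x) \<partial>gaussian n) +
       (\<integral>x. 1 - f i (mat_vec m n S (translate n (\<lambda>j. t * P i j) x)) \<partial>gaussian n)"
      using f01 by (intro gaussian_two_point) (auto simp: measurable_space[OF measurable_mat_vec_fixed])
    then show "exp (- (t\<^sup>2 * P i i) / 4) / 2 \<le> (\<integral>x. f i (mat_vec m n S x) \<partial>gaussian n) +
            (\<integral>x. 1 - f i (mat_vec m n S (translate n (spike i t) x)) \<partial>gaussian n)"
      by (simp add: P_norm[OF i] same_sketch[OF i])
  qed
  finally show ?thesis .
qed

subsection \<open>Testing by means of the decoder\<close>

locale heavy_hitter_sketch =
  fixes m n :: nat and \<epsilon> \<delta> :: real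
    and \<mu> :: "(nat \<times> nat \<Rightarrow> real) measure"
    and D :: "(nat \<times> nat \<Rightarrow> real) \<times> (nat \<Rightarrow> real) \<Rightarrow> nat set measure"
  assumes sketch: "is_sketch m n \<mu>" and decoder: "is_decoder m n D"
    and solves: "solves_heavy_hitters m n \<epsilon> \<delta> \<mu> D"
begin

sublocale \<mu>: prob_space \<mu>
  using sketch by (simp add: is_sketch_def space_prob_algebra)

lemma sets_\<mu> [measurable_cong]: "sets \<mu> = sets (mat_space m n)"
  using sketch by (simp add: is_sketch_def space_prob_algebra)

lemma measurable_D [measurable]:
  "D \<in> mat_space m n \<Otimes>\<^sub>M vec_space m \<rightarrow>\<^sub>M prob_algebra (count_space (Pow {..<n}))"
  using decoder by (simp add: is_decoder_def)

text \<open>The chance, over the decoder's own randomness, that \<open>i\<close> is reported. A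
  randomised decoder thus becomes a test with values between 0 and 1, as the two-point bound
  requires. Intersecting with \<open>Pow {..<n}\<close> makes the event measurable.\<close>

definition accept :: "nat \<Rightarrow> (nat \<times> nat \<Rightarrow> real) \<Rightarrow> (nat \<Rightarrow> real) \<Rightarrow> real" where
  "accept i S y = measure (D (S, y)) {A \<in> Pow {..<n}. i \<in> A}"

lemma measurable_accept [measurable]:
  "(\<lambda>p. accept i (fst p) (snd p)) \<in> borel_measurable (mat_space m n \<Otimes>\<^sub>M vec_space m)"
proof -
  have "(\<lambda>M. measure M {A \<in> Pow {..<n}. i \<in> A}) \<in> borel_measurable (prob_algebra (count_space (Pow {..<n})))"
    by (intro measurable_measure_prob_algebra) auto
  from measurable_compose[OF measurable_D this] show ?thesis by (simp add: accept_def)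
qed

lemma D_prob:
  assumes "S \<in> space (mat_space m n)" "y \<in> space (vec_space m)"
  shows "prob_space (D (S, y))" "sets (D (S, y)) = Pow (Pow {..<n})"
  using measurable_space[OF measurable_D, of "(S, y)"] assms
  by (auto simp: space_pair_measure space_prob_algebra)

lemma accept_bounds:
  assumes "S \<in> space (mat_space m n)" "y \<in> space (vec_space m)"
  shows "0 \<le> accept i S y \<and> accept i S y \<le> 1"
  using prob_space.prob_le_1[OF D_prob(1)[OF assms]] by (simp add: accept_def)

lemma measurable_accept_sketch [measurable]:
  "(\<lambda>p. accept i (fst p) (mat_vec m n (fst p) (snd p))) \<in> borel_measurable (mat_space m n \<Otimes>\<^sub>M vec_space n)"
  using measurable_compose[OF measurable_Pair[OF measurable_fst measurable_mat_vec] measurable_accept[of i]]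
  by simp

lemma accept_sketch_bounds:
  assumes "S \<in> space (mat_space m n)" "x \<in> space (vec_space n)"
  shows "0 \<le> accept i S (mat_vec m n S x) \<and> accept i S (mat_vec m n S x) \<le> 1"
  using accept_bounds[OF assms(1) measurable_space[OF measurable_mat_vec_fixed assms(2)]] .

lemma space_\<mu>: "space \<mu> = space (mat_space m n)"
  by (rule sets_eq_imp_space_eq[OF sets_\<mu>])

text \<open>Here the matrix is averaged out as well, for a fixed input; this is the quantity that
  the success guarantee controls.\<close>

definition accept_prob :: "nat \<Rightarrow> (nat \<Rightarrow> real) \<Rightarrow> real" where
  "accept_prob i x = (\<integral>S. accept i S (mat_vec m n S x) \<partial>\<mu>)"

lemma integrable_accept:
  assumes x: "x \<in> space (vec_space n)"
  shows "integrable \<mu> (\<lambda>S. accept i S (mat_vec m n S x))"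
proof (rule \<mu>.integrable_const_bound[where B=1])
  show "AE S in \<mu>. norm (accept i S (mat_vec m n S x)) \<le> 1"
    using accept_sketch_bounds[OF _ x] by (intro AE_I2) (auto simp: space_\<mu>)
  have "(\<lambda>S. (S, x)) \<in> \<mu> \<rightarrow>\<^sub>M mat_space m n \<Otimes>\<^sub>M vec_space n"
    using x by measurable
  from measurable_compose[OF this measurable_accept_sketch]
  show "(\<lambda>S. accept i S (mat_vec m n S x)) \<in> borel_measurable \<mu>" by simp
qed

lemma accept_prob_bounds:
  assumes x: "x \<in> space (vec_space n)"
  shows "0 \<le> accept_prob i x \<and> accept_prob i x \<le> 1"
proof
  show "0 \<le> accept_prob i x"
    unfolding accept_prob_def by (intro integral_nonneg_AE AE_I2) (auto simp: accept_def)
  show "accept_prob i x \<le> 1"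
    unfolding accept_prob_def
    using accept_sketch_bounds[OF _ x] integrable_accept[OF x]
    by (intro \<mu>.integral_le_const AE_I2) (auto simp: space_\<mu>)
qed

text \<open>The success probability, stated for the composed output law, becomes an average over the
  matrix, which can be compared with \<open>accept\<close> matrix by matrix.\<close>

lemma success_integral:
  fixes x :: "nat \<Rightarrow> real"
  defines "X \<equiv> {A. heavy_hitters n \<epsilon> x \<subseteq> A \<and> A \<subseteq> heavy_hitters n (\<epsilon> / 2) x}"
  assumes x: "x \<in> space (vec_space n)"
  shows "1 - \<delta> \<le> (\<integral>S. measure (D (S, mat_vec m n S x)) X \<partial>\<mu>)"
    and "integrable \<mu> (\<lambda>S. measure (D (S, mat_vec m n S x)) X)"
    and "X \<subseteq> Pow {..<n}"
proof -
  show X: "X \<subseteq> Pow {..<n}" by (auto simp: X_def heavy_hitters_def)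
  have "(\<lambda>S. (S, mat_vec m n S x)) \<in> \<mu> \<rightarrow>\<^sub>M mat_space m n \<Otimes>\<^sub>M vec_space m"
  proof (rule measurable_Pair)
    have "(\<lambda>S. (S, x)) \<in> \<mu> \<rightarrow>\<^sub>M mat_space m n \<Otimes>\<^sub>M vec_space n"
      using x by measurable
    from measurable_compose[OF this measurable_mat_vec]
    show "(\<lambda>S. mat_vec m n S x) \<in> \<mu> \<rightarrow>\<^sub>M vec_space m" by simp
  qed measurable
  then have K: "(\<lambda>S. D (S, mat_vec m n S x)) \<in> \<mu> \<rightarrow>\<^sub>M prob_algebra (count_space (Pow {..<n}))"
    by (rule measurable_compose[OF _ measurable_D])
  have "measure (output_law m n \<mu> D x) X = (\<integral>S. measure (D (S, mat_vec m n S x)) X \<partial>\<mu>)"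
    unfolding output_law_def using X
    by (intro \<mu>.measure_bind[OF measurable_prob_algebraD[OF K]]) auto
  then show "1 - \<delta> \<le> (\<integral>S. measure (D (S, mat_vec m n S x)) X \<partial>\<mu>)"
    using solves x unfolding solves_heavy_hitters_def X_def by metis
  show "integrable \<mu> (\<lambda>S. measure (D (S, mat_vec m n S x)) X)"
  proof (rule \<mu>.integrable_const_bound[where B=1])
    show "AE S in \<mu>. norm (measure (D (S, mat_vec m n S x)) X) \<le> 1"
    proof (intro AE_I2)
      fix S assume "S \<in> space \<mu>"
      then interpret prob_space "D (S, mat_vec m n S x)"
        using measurable_space[OF measurable_mat_vec_fixed x] by (intro D_prob) (auto simp: space_\<mu>)
      show "norm (prob X) \<le> 1" by simp
    qed
    have "(\<lambda>M. measure M X) \<in> borel_measurable (prob_algebra (count_space (Pow {..<n})))"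
      using X by (intro measurable_measure_prob_algebra) auto
    from measurable_compose[OF K this]
    show "(\<lambda>S. measure (D (S, mat_vec m n S x)) X) \<in> borel_measurable \<mu>" .
  qed
qed

text \<open>A successful output does not contain such an \<open>i\<close>, so success and reporting
  \<open>i\<close> are disjoint events for every matrix.\<close>

lemma accept_prob_not_heavy:
  assumes x: "x \<in> space (vec_space n)" and i: "i \<notin> heavy_hitters n (\<epsilon> / 2) x"
  shows "accept_prob i x \<le> \<delta>"
proof -
  let ?X = "{A. heavy_hitters n \<epsilon> x \<subseteq> A \<and> A \<subseteq> heavy_hitters n (\<epsilon> / 2) x}"
  have "1 - \<delta> \<le> (\<integral>S. measure (D (S, mat_vec m n S x)) ?X \<partial>\<mu>)"
    by (rule success_integral(1)[OF x])
  also have "\<dots> \<le> (\<integral>S. 1 - accept i S (mat_vec m n S x) \<partial>\<mu>)"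
  proof (rule integral_mono)
    fix S assume "S \<in> space \<mu>"
    then have S: "S \<in> space (mat_space m n)" by (simp add: space_\<mu>)
    note y = measurable_space[OF measurable_mat_vec_fixed[of m n S] x]
    interpret prob_space "D (S, mat_vec m n S x)" by (rule D_prob(1)[OF S y])
    have "prob ?X + prob {A \<in> Pow {..<n}. i \<in> A} = prob (?X \<union> {A \<in> Pow {..<n}. i \<in> A})"
      using i success_integral(3)[OF x] D_prob(2)[OF S y]
      by (intro finite_measure_Union[symmetric]) auto
    then show "prob ?X \<le> 1 - accept i S (mat_vec m n S x)"
      using prob_le_1[of "?X \<union> {A \<in> Pow {..<n}. i \<in> A}"] unfolding accept_def by linarith
  qed (use success_integral(2)[OF x] integrable_accept[OF x] in auto)
  also have "\<dots> = 1 - accept_prob i x"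
    using integrable_accept[OF x] by (simp add: accept_prob_def \<mu>.prob_space)
  finally show ?thesis by simp
qed

text \<open>Every successful output contains such an \<open>i\<close>, so success is included in the
  event that \<open>i\<close> is reported.\<close>

lemma accept_prob_heavy:
  assumes x: "x \<in> space (vec_space n)" and i: "i \<in> heavy_hitters n \<epsilon> x"
  shows "1 - accept_prob i x \<le> \<delta>"
proof -
  let ?X = "{A. heavy_hitters n \<epsilon> x \<subseteq> A \<and> A \<subseteq> heavy_hitters n (\<epsilon> / 2) x}"
  have "1 - \<delta> \<le> (\<integral>S. measure (D (S, mat_vec m n S x)) ?X \<partial>\<mu>)"
    by (rule success_integral(1)[OF x])
  also have "\<dots> \<le> (\<integral>S. accept i S (mat_vec m n S x) \<partial>\<mu>)"
  proof (rule integral_mono)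
    fix S assume "S \<in> space \<mu>"
    then have S: "S \<in> space (mat_space m n)" by (simp add: space_\<mu>)
    note y = measurable_space[OF measurable_mat_vec_fixed[of m n S] x]
    interpret prob_space "D (S, mat_vec m n S x)" by (rule D_prob(1)[OF S y])
    show "prob ?X \<le> accept i S (mat_vec m n S x)"
      unfolding accept_def using i success_integral(3)[OF x] D_prob(2)[OF S y]
      by (intro finite_measure_mono) auto
  qed (use success_integral(2)[OF x] integrable_accept[OF x] in auto)
  also have "\<dots> = accept_prob i x" by (simp add: accept_prob_def)
  finally show ?thesis by simp
qed

section \<open>Testing error averaged over matrix and Gaussian input\<close>

lemma measurable_accept_prob [measurable]: "accept_prob i \<in> borel_measurable (vec_space n)"
proof -
  have "(\<lambda>x. \<integral>S. accept i S (mat_vec m n S x) \<partial>\<mu>) \<in> borel_measurable (vec_space n)"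
  proof (rule \<mu>.borel_measurable_lebesgue_integral)
    have "(\<lambda>p. (snd p, fst p)) \<in> vec_space n \<Otimes>\<^sub>M \<mu> \<rightarrow>\<^sub>M mat_space m n \<Otimes>\<^sub>M vec_space n"
      by measurable
    from measurable_compose[OF this measurable_accept_sketch]
    show "(\<lambda>(x, S). accept i S (mat_vec m n S x)) \<in> borel_measurable (vec_space n \<Otimes>\<^sub>M \<mu>)"
      by (simp add: case_prod_beta)
  qed
  then show ?thesis by (simp add: accept_prob_def[abs_def])
qed

text \<open>Fubini for a function bounded by 1 on the product of the matrix law and the Gaussian.
  The map \<open>\<tau>\<close> is later the identity or the translation by a spike.\<close>

lemma integral_accept_prob:
  assumes [measurable]: "\<tau> \<in> vec_space n \<rightarrow>\<^sub>M vec_space n"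
  shows "(\<integral>x. accept_prob i (\<tau> x) \<partial>gaussian n)
      = (\<integral>S. (\<integral>x. accept i S (mat_vec m n S (\<tau> x)) \<partial>gaussian n) \<partial>\<mu>)" (is ?eq)
    and "integrable \<mu> (\<lambda>S. \<integral>x. accept i S (mat_vec m n S (\<tau> x)) \<partial>gaussian n)" (is ?int)
proof -
  interpret G: prob_space "gaussian n" by (rule prob_space_gaussian)
  interpret P: pair_prob_space \<mu> "gaussian n" ..
  have "integrable (\<mu> \<Otimes>\<^sub>M gaussian n) (case_prod (\<lambda>S x. accept i S (mat_vec m n S (\<tau> x))))"
  proof (rule P.integrable_const_bound[where B=1])
    have "(\<lambda>p. (fst p, \<tau> (snd p))) \<in> \<mu> \<Otimes>\<^sub>M gaussian n \<rightarrow>\<^sub>M mat_space m n \<Otimes>\<^sub>M vec_space n"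
      by measurable
    from measurable_compose[OF this measurable_accept_sketch]
    show "case_prod (\<lambda>S x. accept i S (mat_vec m n S (\<tau> x))) \<in> borel_measurable (\<mu> \<Otimes>\<^sub>M gaussian n)"
      by (simp add: case_prod_beta')
    show "AE p in \<mu> \<Otimes>\<^sub>M gaussian n. norm (case_prod (\<lambda>S x. accept i S (mat_vec m n S (\<tau> x))) p) \<le> 1"
      using accept_sketch_bounds measurable_space[OF assms]
      by (intro AE_I2) (auto simp: space_pair_measure space_\<mu> space_gaussian)
  qed
  from P.Fubini_integral[OF this] P.integrable_fst[OF this] show ?eq ?int
    by (simp_all add: accept_prob_def)
qed

text \<open>The bound for a fixed matrix does not depend on that matrix, so it survives integration
  over \<open>\<mu>\<close>; exchanging the integrals then yields
  \<open>accept_prob\<close>.\<close>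

lemma error_lower_bound:
  assumes "n > 0"
  shows "real n * (exp (- (t\<^sup>2 * real m / (4 * real n))) / 2) \<le>
    (\<Sum>i<n. (\<integral>x. accept_prob i x \<partial>gaussian n) +
            (\<integral>x. 1 - accept_prob i (translate n (spike i t) x) \<partial>gaussian n))"
proof -
  interpret G: prob_space "gaussian n" by (rule prob_space_gaussian)
  let ?a = "\<lambda>i S. \<integral>x. accept i S (mat_vec m n S x) \<partial>gaussian n"
  let ?b = "\<lambda>i S. \<integral>x. accept i S (mat_vec m n S (translate n (spike i t) x)) \<partial>gaussian n"
  have a: "integrable \<mu> (?a i)" "(\<integral>S. ?a i S \<partial>\<mu>) = (\<integral>x. accept_prob i x \<partial>gaussian n)" for i
    using integral_accept_prob[of "\<lambda>x. x"] by auto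
  have b: "integrable \<mu> (?b i)"
    "(\<integral>S. ?b i S \<partial>\<mu>) = (\<integral>x. accept_prob i (translate n (spike i t) x) \<partial>gaussian n)" for i
    using integral_accept_prob[OF measurable_translate] by auto
  have m_acc: "accept i S \<in> borel_measurable (vec_space m)" if "S \<in> space (mat_space m n)" for i S
  proof -
    have "(\<lambda>y. (S, y)) \<in> vec_space m \<rightarrow>\<^sub>M mat_space m n \<Otimes>\<^sub>M vec_space m"
      using that by measurable
    from measurable_compose[OF this measurable_accept[of i]] show ?thesis by simp
  qed
  have int_x: "integrable (gaussian n) (\<lambda>x. accept i S (mat_vec m n S (translate n v x)))"
    if S: "S \<in> space (mat_space m n)" for i S v
  proof (rule G.integrable_const_bound[where B=1])
    note [measurable] = m_acc[OF S, of i]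
    show "(\<lambda>x. accept i S (mat_vec m n S (translate n v x))) \<in> borel_measurable (gaussian n)"
      by measurable
    show "AE x in gaussian n. norm (accept i S (mat_vec m n S (translate n v x))) \<le> 1"
      using accept_sketch_bounds[OF S] measurable_space[OF measurable_translate]
      by (intro AE_I2) (auto simp: space_gaussian)
  qed
  have int_prob: "integrable (gaussian n) (\<lambda>x. accept_prob i (translate n v x))" for i v
    using accept_prob_bounds measurable_space[OF measurable_translate]
    by (intro G.integrable_const_bound[where B=1] AE_I2) (auto simp: space_gaussian)
  have "real n * (exp (- (t\<^sup>2 * real m / (4 * real n))) / 2) \<le> (\<integral>S. (\<Sum>i<n. ?a i S + (1 - ?b i S)) \<partial>\<mu>)"
  proof (rule \<mu>.integral_ge_const)
    show "integrable \<mu> (\<lambda>S. \<Sum>i<n. ?a i S + (1 - ?b i S))"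
      using a b by (intro Bochner_Integration.integrable_sum Bochner_Integration.integrable_add
        Bochner_Integration.integrable_diff) auto
    show "AE S in \<mu>. real n * (exp (- (t\<^sup>2 * real m / (4 * real n))) / 2) \<le> (\<Sum>i<n. ?a i S + (1 - ?b i S))"
    proof (intro AE_I2)
      fix S assume "S \<in> space \<mu>"
      then have S: "S \<in> space (mat_space m n)" by (simp add: space_\<mu>)
      have "(\<integral>x. 1 - accept i S (mat_vec m n S (translate n (spike i t) x)) \<partial>gaussian n) = 1 - ?b i S" for i
        using int_x[OF S] by (simp add: G.prob_space)
      with sketch_indistinguishable[of "\<lambda>i. accept i S" m n t S] m_acc[OF S] accept_bounds[OF S] \<open>n > 0\<close>
      show "real n * (exp (- (t\<^sup>2 * real m / (4 * real n))) / 2) \<le> (\<Sum>i<n. ?a i S + (1 - ?b i S))"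
        by simp
    qed
  qed
  also have "\<dots> = (\<Sum>i<n. (\<integral>x. accept_prob i x \<partial>gaussian n) +
            (\<integral>x. 1 - accept_prob i (translate n (spike i t) x) \<partial>gaussian n))"
    using a b int_prob by (simp add: \<mu>.prob_space G.prob_space)
  finally show ?thesis .
qed

text \<open>Each integrand is at most \<delta> outside two exceptional events and at most 1 on them.
  Both events have Gaussian probability at most \<delta>: a large coordinate \<open>i\<close>,
  together with a small norm in the first case and a large norm in the second.\<close>

lemma error_upper_bound:
  assumes \<epsilon>: "0 < \<epsilon>" "\<epsilon> < 1 / 100" and \<delta>: "0 < \<delta>" "\<delta> < 1" and n: "64 / \<epsilon> * ln (6 / \<delta>) \<le> real n"
    and i: "i < n"
  defines "t \<equiv> 10 * sqrt (\<epsilon> * real n / 8)"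
  shows "(\<integral>x. accept_prob i x \<partial>gaussian n) \<le> 3 * \<delta>"
    and "(\<integral>x. 1 - accept_prob i (translate n (spike i t) x) \<partial>gaussian n) \<le> 3 * \<delta>"
proof -
  interpret G: prob_space "gaussian n" by (rule prob_space_gaussian)
  \<comment> \<open>All tails are compared with \<open>exp (- K) = \<delta> / 6\<close>. The lower
    bound on \<open>n\<close> makes each of the exponents \<open>3 * \<epsilon> * n / 64\<close>,
    \<open>n / 8\<close> and \<open>n / 2\<close> at least \<open>K\<close>.\<close>
  define K where "K = ln (6 / \<delta>)"
  have K: "K > 0" "exp (- K) = \<delta> / 6" using \<delta> by (simp_all add: K_def exp_minus)
  have nK: "64 * K \<le> \<epsilon> * real n" using n \<epsilon> by (simp add: K_def field_simps)
  also have "\<epsilon> * real n \<le> 1 * real n" using \<epsilon> by (intro mult_right_mono) auto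
  finally have nK': "64 * K \<le> real n" by simp
  let ?big = "{x \<in> space (gaussian n). (x i)\<^sup>2 \<ge> \<epsilon> * real n / 8}"
  let ?lo = "{x \<in> space (gaussian n). (\<Sum>j<n. (x j)\<^sup>2) \<le> real n / 4}"
  let ?hi = "{x \<in> space (gaussian n). (\<Sum>j<n. (x j)\<^sup>2) \<ge> 4 * real n}"
  have norm_measurable: "(\<lambda>x. \<Sum>j<n. (x j)\<^sup>2) \<in> borel_measurable (vec_space n)" by measurable
  have coord_measurable: "(\<lambda>x. x i) \<in> borel_measurable (vec_space n)" using i by (intro measurable_component_singleton) simp
  have sets [measurable]: "?big \<in> sets (gaussian n)" "?lo \<in> sets (gaussian n)" "?hi \<in> sets (gaussian n)"
    using norm_measurable coord_measurable by measurable
  have two_indicators: "(\<integral>x. \<delta> + indicator A x + indicator B x \<partial>gaussian n) = \<delta> + G.prob A + G.prob B"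
    if "A \<in> sets (gaussian n)" "B \<in> sets (gaussian n)" for A B
    using that by (simp add: G.prob_space less_top[symmetric])
  have "G.prob ?big \<le> 2 * exp (- (3 / 8 * (\<epsilon> * real n / 8)))"
    by (rule gaussian_coordinate_tail[OF i])
  also have "\<dots> \<le> 2 * exp (- K)" using nK K by simp
  finally have big: "G.prob ?big \<le> \<delta>" using K \<delta> by simp
  have "G.prob ?lo \<le> exp (- (real n / 8))" by (rule gaussian_norm_lower_tail)
  also have "\<dots> \<le> exp (- K)" using nK' K by simp
  finally have lo: "G.prob ?lo \<le> \<delta>" using K \<delta> by simp
  have "G.prob ?hi \<le> exp (- (real n / 2))" by (rule gaussian_norm_upper_tail)
  also have "\<dots> \<le> exp (- K)" using nK' K by simp
  finally have hi: "G.prob ?hi \<le> \<delta>" using K \<delta> by simp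
  have int: "integrable (gaussian n) (\<lambda>x. accept_prob i (translate n v x))" for v
    using accept_prob_bounds measurable_space[OF measurable_translate]
    by (intro G.integrable_const_bound[where B=1] AE_I2) (auto simp: space_gaussian)
  have int': "integrable (gaussian n) (accept_prob i)"
    using accept_prob_bounds by (intro G.integrable_const_bound[where B=1] AE_I2) (auto simp: space_gaussian)
  have "(\<integral>x. accept_prob i x \<partial>gaussian n) \<le> (\<integral>x. \<delta> + indicator ?big x + indicator ?lo x \<partial>gaussian n)"
  proof (rule integral_mono[OF int'])
    fix x assume x: "x \<in> space (gaussian n)"
    show "accept_prob i x \<le> \<delta> + indicator ?big x + indicator ?lo x"
    proof (cases "x \<in> ?big \<union> ?lo")
      case True
      then show ?thesis using accept_prob_bounds[of x i] x \<delta> by (auto simp: space_gaussian indicator_def)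
    next
      case False
      then have "accept_prob i x \<le> \<delta>"
        using x \<epsilon> by (intro accept_prob_not_heavy not_heavy_hitter) (auto simp: space_gaussian)
      then show ?thesis using False by (simp add: indicator_def)
    qed
  qed (use sets in \<open>auto simp: less_top[symmetric]\<close>)
  also have "\<dots> = \<delta> + G.prob ?big + G.prob ?lo"
    using sets by (intro two_indicators)
  finally show "(\<integral>x. accept_prob i x \<partial>gaussian n) \<le> 3 * \<delta>" using big lo by simp
  have "(\<integral>x. 1 - accept_prob i (translate n (spike i t) x) \<partial>gaussian n)
      \<le> (\<integral>x. \<delta> + indicator ?big x + indicator ?hi x \<partial>gaussian n)"
  proof (rule integral_mono)
    fix x assume x: "x \<in> space (gaussian n)"
    then have tx: "translate n (spike i t) x \<in> space (vec_space n)"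
      using measurable_space[OF measurable_translate] by (auto simp: space_gaussian)
    show "1 - accept_prob i (translate n (spike i t) x) \<le> \<delta> + indicator ?big x + indicator ?hi x"
    proof (cases "x \<in> ?big \<union> ?hi")
      case True
      then show ?thesis using accept_prob_bounds[OF tx, of i] \<delta> by (auto simp: indicator_def)
    next
      case False
      then have "1 - accept_prob i (translate n (spike i t) x) \<le> \<delta>"
        using x \<epsilon> i unfolding t_def
        by (intro accept_prob_heavy spike_heavy_hitter tx[unfolded t_def]) auto
      then show ?thesis using False by (simp add: indicator_def)
    qed
  qed (use sets int in \<open>auto simp: less_top[symmetric]\<close>)
  also have "\<dots> = \<delta> + G.prob ?big + G.prob ?hi"
    using sets by (intro two_indicators)
  finally show "(\<integral>x. 1 - accept_prob i (translate n (spike i t) x) \<partial>gaussian n) \<le> 3 * \<delta>" using big hi by simp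
qed

text \<open>Comparing the two error bounds gives
  \<open>exp (- 25 / 8 * \<epsilon> * m) \<le> 12 * \<delta>\<close>. Since \<delta> < 1/144, the
  constant 12 costs at most half of \<open>ln (1 / \<delta>)\<close>, which leaves
  \<open>4 / 25\<close> as the final factor.\<close>

lemma rows_lower_bound:
  assumes \<epsilon>: "0 < \<epsilon>" "\<epsilon> < 1 / 100" and \<delta>: "0 < \<delta>" "\<delta> < 1 / 144" and n: "64 / \<epsilon> * ln (6 / \<delta>) \<le> real n"
  shows "4 / 25 * inverse \<epsilon> * ln (1 / \<delta>) \<le> real m"
proof -
  define t where "t = 10 * sqrt (\<epsilon> * real n / 8)"
  have "0 < 64 / \<epsilon> * ln (6 / \<delta>)" using \<epsilon> \<delta> by simp
  then have n0: "n > 0" using n by (cases n) auto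
  have t2: "t\<^sup>2 = 100 * (\<epsilon> * real n / 8)" using \<epsilon> by (simp add: t_def power_mult_distrib)
  have "real n * (exp (- (t\<^sup>2 * real m / (4 * real n))) / 2) \<le>
    (\<Sum>i<n. (\<integral>x. accept_prob i x \<partial>gaussian n) +
            (\<integral>x. 1 - accept_prob i (translate n (spike i t) x) \<partial>gaussian n))"
    by (rule error_lower_bound[OF n0])
  also have "\<dots> \<le> (\<Sum>i<n. 3 * \<delta> + 3 * \<delta>)"
    using \<delta> unfolding t_def
    by (intro sum_mono add_mono error_upper_bound[OF \<epsilon> \<delta>(1) _ n]) auto
  finally have "exp (- (t\<^sup>2 * real m / (4 * real n))) \<le> 12 * \<delta>" using n0 by simp
  \<comment> \<open>The choice of \<open>t\<close> makes the dimension \<open>n\<close> cancel from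
    the exponent.\<close>
  moreover have "t\<^sup>2 * real m / (4 * real n) = 25 / 8 * (\<epsilon> * real m)" using n0 by (simp add: t2)
  ultimately have "ln (exp (- (25 / 8 * (\<epsilon> * real m)))) \<le> ln (12 * \<delta>)"
    using \<delta> by (subst ln_le_cancel_iff) auto
  then have "- (ln 12 + ln \<delta>) \<le> 25 / 8 * (\<epsilon> * real m)" using \<delta> by (simp add: ln_mult)
  \<comment> \<open>This uses \<open>144 = 12^2\<close>, the reason for the threshold on
    \<delta>.\<close>
  moreover have "ln \<delta> \<le> - (2 * ln 12)"
  proof -
    have "ln \<delta> \<le> ln (1 / 144)" using \<delta> by (subst ln_le_cancel_iff) auto
    also have "ln (1 / 144 :: real) = - ln (12 ^ 2)" by (simp add: ln_div)
    also have "\<dots> = - (2 * ln 12)" by (subst ln_realpow) auto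
    finally show ?thesis .
  qed
  moreover have "ln (1 / \<delta>) = - ln \<delta>" using \<delta> by (simp add: ln_div)
  ultimately have "4 / 25 * ln (1 / \<delta>) \<le> \<epsilon> * real m" by linarith
  then show ?thesis using \<epsilon> by (simp add: field_simps)
qed

end

theorem theorem7:
  "\<exists>\<delta>\<^sub>0 \<epsilon>\<^sub>0 c :: real. 0 < \<delta>\<^sub>0 \<and> \<delta>\<^sub>0 < 1 \<and> 0 < \<epsilon>\<^sub>0 \<and> \<epsilon>\<^sub>0 < 1 \<and> 0 < c \<and>
     (\<forall>(\<delta>::real) (\<epsilon>::real) (n::nat) (m::nat) \<mu> D.
        0 < \<delta> \<longrightarrow> \<delta> < \<delta>\<^sub>0 \<longrightarrow> 0 < \<epsilon> \<longrightarrow> \<epsilon> < \<epsilon>\<^sub>0 \<longrightarrow>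
        int n \<ge> \<lceil>64 * inverse \<epsilon> * ln (6 / \<delta>)\<rceil> \<longrightarrow>
        is_sketch m n \<mu> \<longrightarrow> is_decoder m n D \<longrightarrow>
        solves_heavy_hitters m n \<epsilon> \<delta> \<mu> D \<longrightarrow>
        real m \<ge> c * inverse \<epsilon> * ln (1 / \<delta>))"
\<comment> \<open>The value 1/144 absorbs the factor 12 in the error comparison, 1/100 keeps a spike
  from inflating the norm too much, and 4/25 is half of 8/25, the inverse of the exponent's
  coefficient.\<close>
proof (rule exI[of _ "1 / 144"], rule exI[of _ "1 / 100"], rule exI[of _ "4 / 25"], intro conjI allI impI)
  fix \<delta> \<epsilon> :: real and n m :: nat and \<mu> D
  assume \<delta>: "0 < \<delta>" "\<delta> < 1 / 144" and \<epsilon>: "0 < \<epsilon>" "\<epsilon> < 1 / 100"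
    and n: "\<lceil>64 * inverse \<epsilon> * ln (6 / \<delta>)\<rceil> \<le> int n"
    and hh: "is_sketch m n \<mu>" "is_decoder m n D" "solves_heavy_hitters m n \<epsilon> \<delta> \<mu> D"
  interpret heavy_hitter_sketch m n \<epsilon> \<delta> \<mu> D using hh by unfold_locales
  have "64 / \<epsilon> * ln (6 / \<delta>) \<le> real n"
    using n by (simp add: ceiling_le_iff divide_inverse)
  then show "4 / 25 * inverse \<epsilon> * ln (1 / \<delta>) \<le> real m"
    by (rule rows_lower_bound[OF \<epsilon> \<delta>])
qed auto

end
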